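(* Let $\alpha,\beta\in\mathbb{C}$ with $\alpha+\beta\neq 0$. Let $\psi(u,z)=\sum_{k,\ell\ge 0}a_{k,\ell}u^kz^\ell$ be the solution of $$-\psi\psi_u+u\psi_u^2+\tfrac12\psi_z^2=0$$ with data $$\psi_{0,0}=1,\qquad \psi_{0,1}=\alpha+\beta,\qquad \psi_{0,2}=2\alpha\beta,\qquad \psi_{0,\ell}=0\ \text{ for }\ell\ge 3 .$$ Then $\psi(u,0)=\sum_{k=0}^\infty a_{k,0}u^k$ with $a_{0,0}=1$, $a_{1,0}=\tfrac12(\alpha+\beta)^2$, and $$a_{k,0}=\frac{(-1)^{k+1}}{2\,k!}(\alpha-\beta)^2(\alpha+\beta)^2Q_k(\alpha,\beta)\qquad\text{for all }k\ge 2,$$ where $$Q_k(\alpha,\beta)=\frac{(k-2)!}{2^{k-2}}\sum_{j=1}^{k-1}\frac{(2j-1)!\,(2k-2j-1)!}{((j-1)!)^2\,((k-j-1)!)^2}\,\alpha^{2k-2j-2}\beta^{2j-2}$$ is a symmetric polynomial in $\alpha$ and $\beta$, homogeneous of degree $2k-4$, whose sum of coefficients of the $\alpha^{2k-2j-2}\beta^{2j-2}$ ($j=1,\ldots,k-1$) is equal to $2^{k-3}k!$. Furthermore, the series $\sum_{k\ge0} a_{k,0}u^k$ converges absolutely for all $u$ satisfying $|u|\le \dfrac{1}{2\mu^2}$, where $\mu=\max\{|\alpha|,|\beta|\}$.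
   Context: Subscripts $u,z$ denote partial derivatives: $\psi_u=\partial\psi/\partial u$, $\psi_z=\partial\psi/\partial z$. Numerical double subscripts denote values of derivatives at the origin: $\psi_{k,\ell}=\dfrac{\partial^{k+\ell}\psi}{\partial u^k\,\partial z^\ell}(0,0)$, so $a_{k,\ell}=\psi_{k,\ell}/(k!\,\ell!)$. The function $\psi$ is complex-valued. *)

theory Defs
  imports "HOL-Complex_Analysis.Complex_Analysis" "HOL-Computational_Algebra.Polynomial"
begin

definition pd_u :: "(complex \<Rightarrow> complex \<Rightarrow> complex) \<Rightarrow> complex \<Rightarrow> complex \<Rightarrow> complex" where
  "pd_u \<psi> u z = deriv (\<lambda>v. \<psi> v z) u"

definition pd_z :: "(complex \<Rightarrow> complex \<Rightarrow> complex) \<Rightarrow> complex \<Rightarrow> complex \<Rightarrow> complex" where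
  "pd_z \<psi> u z = deriv (\<lambda>w. \<psi> u w) z"

text \<open>\<open>deriv_at_0 \<psi> k l\<close> is \<open>\<psi>\<^sub>k\<^sub>,\<^sub>l\<close>, and \<open>taylor_coeff \<psi> k l\<close> is \<open>a\<^sub>k\<^sub>,\<^sub>l\<close>.\<close>

definition deriv_at_0 :: "(complex \<Rightarrow> complex \<Rightarrow> complex) \<Rightarrow> nat \<Rightarrow> nat \<Rightarrow> complex" where
  "deriv_at_0 \<psi> k l = ((pd_u ^^ k) ((pd_z ^^ l) \<psi>)) 0 0"

definition taylor_coeff :: "(complex \<Rightarrow> complex \<Rightarrow> complex) \<Rightarrow> nat \<Rightarrow> nat \<Rightarrow> complex" where
  "taylor_coeff \<psi> k l = deriv_at_0 \<psi> k l / (fact k * fact l)"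

text \<open>The natural-number subtractions are exact for \<open>k \<ge> 2\<close>.\<close>

definition Q :: "nat \<Rightarrow> complex \<Rightarrow> complex \<Rightarrow> complex" where
  "Q k \<alpha> \<beta> = fact (k - 2) / 2 ^ (k - 2) *
     (\<Sum>j = 1..k - 1. fact (2 * j - 1) * fact (2 * k - 2 * j - 1) /
        ((fact (j - 1))\<^sup>2 * (fact (k - j - 1))\<^sup>2) *
        \<alpha> ^ (2 * k - 2 * j - 2) * \<beta> ^ (2 * j - 2))"

text \<open>
  A polynomial in two variables \<open>x\<close>, \<open>y\<close> is a polynomial in \<open>y\<close> (outer) whose coefficients
  are polynomials in \<open>x\<close> (inner).
\<close>

definition eval2 :: "complex poly poly \<Rightarrow> complex \<Rightarrow> complex \<Rightarrow> complex" where
  "eval2 P x y = poly (poly P [:y:]) x"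

definition coeff2 :: "complex poly poly \<Rightarrow> nat \<Rightarrow> nat \<Rightarrow> complex" where
  "coeff2 P m n = coeff (coeff P n) m" \<comment> \<open>the coefficient of \<open>x^m * y^n\<close>\<close>

definition symmetric2 :: "complex poly poly \<Rightarrow> bool" where
  "symmetric2 P \<longleftrightarrow> (\<forall>m n. coeff2 P m n = coeff2 P n m)"

definition homogeneous2 :: "nat \<Rightarrow> complex poly poly \<Rightarrow> bool" where
  "homogeneous2 d P \<longleftrightarrow> (\<forall>m n. coeff2 P m n \<noteq> 0 \<longrightarrow> m + n = d)"

end

theory Submission
  imports Defs
begin

text \<open>
  The initial datum is \<open>\<psi>(0,z) = (1 + \<alpha>z)(1 + \<beta>z)\<close>.  Along a characteristic of the equation
  \<open>\<psi>\<psi>\<^sub>u = u\<psi>\<^sub>u\<^sup>2 + \<psi>\<^sub>z\<^sup>2/2\<close> the derivative \<open>\<psi>\<^sub>u\<close> is constant, so the characteristics can be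
  computed explicitly, and eliminating their parameter gives
  \<open>2\<psi> = ab + 2\<alpha>\<beta>u + \<surd>((a\<^sup>2 + 2\<alpha>\<^sup>2u)(b\<^sup>2 + 2\<beta>\<^sup>2u))\<close>, where \<open>a = 1 + \<alpha>z\<close> and \<open>b = 1 + \<beta>z\<close>.
  To make this rigorous it suffices to check that this \<open>\<psi>\<close> solves the equation and that the
  solution with given \<open>\<psi>(0,z)\<close> is unique.

  Both checks are done for formal power series in \<open>u\<close> whose coefficients are formal power series
  in \<open>z\<close> (type \<open>complex fps fps\<close>).  There the equation determines the coefficients of \<open>u\<close>, \<open>u\<^sup>2\<close>
  and so on recursively, because \<open>\<psi>(0,z)\<close> is not zero (\<open>formal_solution_unique\<close>); the square roots
  are binomial series (\<open>formal_solution_explicit_solution\<close>).  A convergent solution gives a formal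
  one by comparison of coefficients (\<open>formal_solution_of_analytic_solution\<close>).

  At \<open>z = 0\<close> this leaves \<open>2\<psi>(u,0) = 1 + 2\<alpha>\<beta>u + \<surd>P\<close> with \<open>P = (1 + 2\<alpha>\<^sup>2u)(1 + 2\<beta>\<^sup>2u)\<close>.  As \<open>P\<close> is
  quadratic, \<open>(\<surd>P)''\<close> is a constant times the power of \<open>P\<close> with exponent \<open>-3/2\<close>; the constant is
  minus a quarter of the discriminant of \<open>P\<close>, that is, \<open>-(\<alpha>\<^sup>2 - \<beta>\<^sup>2)\<^sup>2\<close>.  This is where the factor
  \<open>(\<alpha> - \<beta>)\<^sup>2(\<alpha> + \<beta>)\<^sup>2\<close> comes from, and the coefficients of the series with exponent \<open>-3/2\<close> give \<open>Q\<close>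
  (\<open>sqrt_product_coeff_Q\<close>).  The sum of the coefficients of \<open>Q\<close> is its value at \<open>\<alpha> = \<beta> = 1\<close>, where
  the series becomes the power of \<open>1 + 2u\<close> with exponent \<open>-3\<close>.  Finally, the binomial series with
  exponent \<open>1/2\<close> converges absolutely on the closed unit disc, hence so does the Cauchy product
  for \<open>\<surd>P\<close> when \<open>|2\<alpha>\<^sup>2u|\<close> and \<open>|2\<beta>\<^sup>2u|\<close> are at most \<open>1\<close> (\<open>summable_sqrt_product\<close>).
\<close>

section \<open>The equation for iterated formal power series\<close>

text \<open>
  In \<open>'a fps fps\<close> the outer variable is \<open>u\<close> and the inner one is \<open>z\<close>.  So \<open>fps_deriv\<close> is
  differentiation by \<open>u\<close>, and differentiation by \<open>z\<close> acts on the coefficients.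
\<close>

definition fps_dz :: "'a::comm_semiring_1 fps fps \<Rightarrow> 'a fps fps" where
  "fps_dz F = Abs_fps (\<lambda>n. fps_deriv (fps_nth F n))"

lemma fps_dz_nth [simp]: "fps_nth (fps_dz F) n = fps_deriv (fps_nth F n)"
  by (simp add: fps_dz_def)

lemma fps_dz_add [simp]: "fps_dz (F + G) = fps_dz F + fps_dz G"
  by (intro fps_ext) simp

lemma fps_dz_mult [simp]: "fps_dz (F * G) = F * fps_dz G + fps_dz F * G"
  by (intro fps_ext) (simp add: fps_mult_nth fps_deriv_sum sum.distrib)

lemma fps_dz_const [simp]: "fps_dz (fps_const c) = fps_const (fps_deriv c)"
  by (rule fps_ext) simp

lemma fps_dz_X [simp]: "fps_dz fps_X = 0"
  by (intro fps_ext) (simp add: fps_X_nth)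

lemma fps_nth_double: "fps_nth (2 * F) n = 2 * fps_nth F n"
  by (simp only: mult_2 fps_add_nth)

text \<open>
  The equation is doubled, so that it makes sense over any commutative ring.
\<close>

definition formal_solution :: "'a::comm_ring_1 fps fps \<Rightarrow> bool" where
  "formal_solution F \<longleftrightarrow>
     2 * F * fps_deriv F = 2 * fps_X * (fps_deriv F)\<^sup>2 + (fps_dz F)\<^sup>2"

text \<open>
  In the coefficient of \<open>u\<^sup>n\<close> of the equation, \<open>F\<^sub>n\<^sub>+\<^sub>1\<close> occurs only in the term \<open>2(n+1)F\<^sub>0F\<^sub>n\<^sub>+\<^sub>1\<close> of
  \<open>2FF'\<close>: the factor \<open>u\<close> lowers the index in \<open>uF'\<^sup>2\<close>, and there is no \<open>u\<close>-derivative in the last term.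
  The ring of coefficients is a domain of characteristic zero, so \<open>2(n+1)F\<^sub>0\<close> can be cancelled.
\<close>

lemma formal_solution_unique:
  fixes F G :: "'a::{idom, semiring_char_0} fps fps"
  assumes F: "formal_solution F" and G: "formal_solution G"
    and eq0: "fps_nth F 0 = fps_nth G 0" and nz: "fps_nth F 0 \<noteq> 0"
  shows "F = G"
proof (rule fps_ext)
  have expand: "2 * (of_nat (Suc n) * (fps_nth H 0 * fps_nth H (Suc n))) =
      2 * (if n = 0 then 0 else \<Sum>i=0..n-1. (of_nat (i+1) * fps_nth H (i+1)) * (of_nat (n-1-i+1) * fps_nth H (n-1-i+1)))
      + (\<Sum>i=0..n. fps_deriv (fps_nth H i) * fps_deriv (fps_nth H (n-i)))
      - 2 * (\<Sum>i=1..n. fps_nth H i * (of_nat (n-i+1) * fps_nth H (n-i+1)))"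
    if "formal_solution H" for H :: "'a fps fps" and n
  proof -
    have "fps_nth (2 * (H * fps_deriv H)) n =
          fps_nth (2 * (fps_X * (fps_deriv H * fps_deriv H)) + fps_dz H * fps_dz H) n"
      using that by (simp add: formal_solution_def power2_eq_square mult.assoc)
    moreover have "fps_nth (H * fps_deriv H) n = of_nat (Suc n) * (fps_nth H 0 * fps_nth H (Suc n))
        + (\<Sum>i=1..n. fps_nth H i * (of_nat (n-i+1) * fps_nth H (n-i+1)))"
      unfolding fps_mult_nth by (subst sum.atLeast_Suc_atMost) (simp_all add: mult.left_commute)
    moreover have "fps_nth (fps_X * (fps_deriv H * fps_deriv H)) n = (if n = 0 then 0 else
        \<Sum>i=0..n-1. (of_nat (i+1) * fps_nth H (i+1)) * (of_nat (n-1-i+1) * fps_nth H (n-1-i+1)))"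
      by (simp only: fps_X_mult_nth fps_mult_nth[of "fps_deriv H"] fps_deriv_nth)
    moreover have "fps_nth (fps_dz H * fps_dz H) n =
        (\<Sum>i=0..n. fps_deriv (fps_nth H i) * fps_deriv (fps_nth H (n-i)))"
      by (simp add: fps_mult_nth)
    ultimately show ?thesis
      by (simp only: fps_nth_double fps_add_nth eq_diff_eq distrib_left)
  qed
  fix k
  show "fps_nth F k = fps_nth G k"
  proof (induction k rule: less_induct)
    case (less k)
    show ?case
    proof (cases k)
      case 0
      then show ?thesis using eq0 by simp
    next
      case (Suc n)
      have IH: "fps_nth F i = fps_nth G i" if "i \<le> n" for i
        using less that Suc by simp
      have "2 * (of_nat (Suc n) * (fps_nth F 0 * fps_nth F (Suc n))) =
            2 * (of_nat (Suc n) * (fps_nth G 0 * fps_nth G (Suc n)))"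
        unfolding expand[OF F] expand[OF G]
        by (intro arg_cong2[of _ _ _ _ "(+)"] arg_cong2[of _ _ _ _ "(-)"]
              arg_cong2[of _ _ _ _ "(*)"] if_cong sum.cong refl arg_cong[of _ _ fps_deriv] IH)
           auto
      then have "fps_nth F (Suc n) = fps_nth G (Suc n)"
        using eq0 nz by (simp del: of_nat_Suc)
      then show ?thesis using Suc by simp
    qed
  qed
qed

section \<open>The closed form of the solution\<close>

text \<open>
  The verification of the closed form as a polynomial identity, to be used with \<open>R\<close> and \<open>S\<close> the two
  square roots, \<open>Ru\<close>, \<open>Rz\<close>, \<open>Su\<close>, \<open>Sz\<close> their partial derivatives, and \<open>Wu\<close>, \<open>Wz\<close> those of \<open>W\<close>.
  After multiplication by \<open>RS\<close> everything is expressed by \<open>P = \<alpha>S + \<beta>R\<close> and \<open>T = aS + bR\<close>: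
  \<open>2RS\<cdot>Wu = P\<^sup>2\<close>, \<open>2RS\<cdot>Wz = PT\<close> and \<open>4RS\<cdot>W = 2uP\<^sup>2 + T\<^sup>2\<close>.  The equation is then the identity
  \<open>(2uP\<^sup>2 + T\<^sup>2)P\<^sup>2 = 2u(P\<^sup>2)\<^sup>2 + (PT)\<^sup>2\<close>.
\<close>

lemma explicit_solution_algebra:
  fixes R S W a b \<alpha> \<beta> u :: "'a::{idom, semiring_char_0}"
  assumes W: "2 * W = a * b + 2 * \<alpha> * \<beta> * u + R * S"
    and R: "R\<^sup>2 = a\<^sup>2 + 2 * \<alpha>\<^sup>2 * u" and S: "S\<^sup>2 = b\<^sup>2 + 2 * \<beta>\<^sup>2 * u"
    and Ru: "R * Ru = \<alpha>\<^sup>2" and Su: "S * Su = \<beta>\<^sup>2"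
    and Rz: "R * Rz = \<alpha> * a" and Sz: "S * Sz = \<beta> * b"
    and Wu: "2 * Wu = 2 * \<alpha> * \<beta> + R * Su + Ru * S"
    and Wz: "2 * Wz = \<alpha> * b + a * \<beta> + R * Sz + Rz * S"
    and nz: "R \<noteq> 0" "S \<noteq> 0"
  shows "2 * W * Wu = 2 * u * Wu\<^sup>2 + Wz\<^sup>2"
proof -
  define P T where "P = \<alpha> * S + \<beta> * R" and "T = a * S + b * R"
  have 1: "R * S * (2 * Wu) = P\<^sup>2"
  proof -
    have "R * S * (2 * Wu) = 2 * \<alpha> * \<beta> * R * S + R\<^sup>2 * (S * Su) + S\<^sup>2 * (R * Ru)"
      unfolding Wu by (simp add: algebra_simps power2_eq_square)
    then show ?thesis unfolding Ru Su P_def by (simp add: algebra_simps power2_eq_square)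
  qed
  have 2: "R * S * (2 * Wz) = P * T"
  proof -
    have "R * S * (2 * Wz) = (\<alpha> * b + a * \<beta>) * R * S + R\<^sup>2 * (S * Sz) + S\<^sup>2 * (R * Rz)"
      unfolding Wz by (simp add: algebra_simps power2_eq_square)
    then show ?thesis unfolding Rz Sz P_def T_def by (simp add: algebra_simps power2_eq_square)
  qed
  have 3: "R * S * (2 * (2 * W)) = 2 * u * P\<^sup>2 + T\<^sup>2"
  proof -
    have "2 * u * P\<^sup>2 + T\<^sup>2 = S\<^sup>2 * (a\<^sup>2 + 2 * \<alpha>\<^sup>2 * u) + R\<^sup>2 * (b\<^sup>2 + 2 * \<beta>\<^sup>2 * u)
        + R * S * (4 * \<alpha> * \<beta> * u + 2 * a * b)"
      unfolding P_def T_def by (simp add: algebra_simps power2_eq_square)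
    then show ?thesis unfolding W R[symmetric] S[symmetric]
      by (simp add: algebra_simps power2_eq_square)
  qed
  have "4 * (R * S)\<^sup>2 * (2 * W * Wu) = (R * S * (2 * (2 * W))) * (R * S * (2 * Wu))"
    by (simp add: algebra_simps power2_eq_square)
  also have "\<dots> = 2 * u * (R * S * (2 * Wu))\<^sup>2 + (R * S * (2 * Wz))\<^sup>2"
    unfolding 1 2 3 by (simp add: algebra_simps power2_eq_square)
  also have "\<dots> = 4 * (R * S)\<^sup>2 * (2 * u * Wu\<^sup>2 + Wz\<^sup>2)"
    by (simp add: algebra_simps power2_eq_square)
  finally have "4 * (R * S)\<^sup>2 * (2 * W * Wu) = 4 * (R * S)\<^sup>2 * (2 * u * Wu\<^sup>2 + Wz\<^sup>2)" .
  moreover have "4 * (R * S)\<^sup>2 \<noteq> 0" using nz by simp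
  ultimately show ?thesis by (metis mult_left_cancel)
qed

text \<open>
  The power \<open>(1 + xu)\<^sup>c\<close>, where \<open>x\<close> is a power series in \<open>z\<close>.
\<close>

definition binomial_series :: "complex \<Rightarrow> complex fps \<Rightarrow> complex fps fps" where
  "binomial_series c x = Abs_fps (\<lambda>n. fps_const (c gchoose n) * x ^ n)"

lemma binomial_series_nth [simp]:
  "fps_nth (binomial_series c x) n = fps_const (c gchoose n) * x ^ n"
  by (simp add: binomial_series_def)

lemma fps_const_sum: "fps_const (\<Sum>i\<in>A. f i) = (\<Sum>i\<in>A. fps_const (f i))"
  by (induction A rule: infinite_finite_induct) (simp_all flip: fps_const_add)

lemma binomial_series_mult:
  "binomial_series c x * binomial_series d x = binomial_series (c + d) x"
proof (rule fps_ext)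
  fix n
  have "fps_nth (binomial_series c x * binomial_series d x) n =
        (\<Sum>i=0..n. fps_const ((c gchoose i) * (d gchoose (n - i))) * x ^ n)"
    unfolding fps_mult_nth
    by (intro sum.cong refl)
       (simp add: fps_const_mult[symmetric] mult_ac flip: power_add del: fps_const_mult)
  also have "\<dots> = fps_const (\<Sum>i=0..n. (c gchoose i) * (d gchoose (n - i))) * x ^ n"
    by (simp add: fps_const_sum sum_distrib_right)
  finally show "fps_nth (binomial_series c x * binomial_series d x) n =
      fps_nth (binomial_series (c + d) x) n"
    by (simp add: gbinomial_Vandermonde)
qed

lemma binomial_series_1: "binomial_series 1 x = 1 + fps_const x * fps_X"
proof (rule fps_ext)
  fix n
  have "(1::complex) gchoose n = (if n \<le> 1 then 1 else 0)"
    using binomial_gbinomial[of 1 n, where 'a=complex] by (auto simp: binomial_eq_0 le_Suc_eq)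
  then show "fps_nth (binomial_series 1 x) n = fps_nth (1 + fps_const x * fps_X) n"
    by (cases n) (auto simp: fps_X_nth)
qed

text \<open>
  The square root of \<open>a\<^sup>2 + 2\<alpha>\<^sup>2u\<close>, obtained as \<open>a\<close> times the square root of \<open>1 + (2\<alpha>\<^sup>2/a\<^sup>2)u\<close>;
  here \<open>a = 1 + \<alpha>z\<close> is invertible as a power series in \<open>z\<close>.
\<close>

definition sqrt_series :: "complex \<Rightarrow> complex fps fps" where
  "sqrt_series \<alpha> = (let a = 1 + fps_const \<alpha> * fps_X
     in fps_const a * binomial_series (1 / 2) (fps_const (2 * \<alpha>\<^sup>2) * inverse (a\<^sup>2)))"

lemma sqrt_series_square:
  "(sqrt_series \<alpha>)\<^sup>2 = fps_const ((1 + fps_const \<alpha> * fps_X)\<^sup>2) + fps_const (fps_const (2 * \<alpha>\<^sup>2)) * fps_X"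
proof -
  define a :: "complex fps" where "a = 1 + fps_const \<alpha> * fps_X"
  define x where "x = fps_const (2 * \<alpha>\<^sup>2) * inverse (a\<^sup>2)"
  have "a\<^sup>2 * inverse (a\<^sup>2) = 1"
    using inverse_mult_eq_1[of "a\<^sup>2"] by (simp add: a_def power2_eq_square mult.commute)
  then have ax: "a\<^sup>2 * x = fps_const (2 * \<alpha>\<^sup>2)"
    unfolding x_def by (metis mult.left_commute mult.right_neutral)
  have "(sqrt_series \<alpha>)\<^sup>2 = fps_const a * fps_const a * (binomial_series (1/2) x * binomial_series (1/2) x)"
    by (simp add: sqrt_series_def Let_def a_def x_def power2_eq_square mult_ac)
  also have "\<dots> = fps_const (a\<^sup>2) * (1 + fps_const x * fps_X)"
    by (simp add: binomial_series_mult binomial_series_1 power2_eq_square)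
  also have "\<dots> = fps_const (a\<^sup>2) + fps_const (a\<^sup>2 * x) * fps_X"
    by (simp add: distrib_left flip: fps_const_mult mult.assoc)
  finally show ?thesis unfolding ax by (simp only: a_def)
qed

lemma sqrt_series_nth_0: "fps_nth (sqrt_series \<alpha>) 0 = 1 + fps_const \<alpha> * fps_X"
  by (simp add: sqrt_series_def Let_def)

lemma sqrt_series_nth_nth_0:
  "fps_nth (fps_nth (sqrt_series \<alpha>) n) 0 = (1 / 2 gchoose n) * (2 * \<alpha>\<^sup>2) ^ n"
  by (simp add: sqrt_series_def Let_def fps_power_zeroth)

definition explicit_solution :: "complex \<Rightarrow> complex \<Rightarrow> complex fps fps" where
  "explicit_solution \<alpha> \<beta> = fps_const (fps_const (1 / 2)) *
     (fps_const ((1 + fps_const \<alpha> * fps_X) * (1 + fps_const \<beta> * fps_X))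
       + 2 * fps_const (fps_const \<alpha>) * fps_const (fps_const \<beta>) * fps_X + sqrt_series \<alpha> * sqrt_series \<beta>)"

lemma explicit_solution_double:
  "2 * explicit_solution \<alpha> \<beta> =
     fps_const (1 + fps_const \<alpha> * fps_X) * fps_const (1 + fps_const \<beta> * fps_X)
       + 2 * fps_const (fps_const \<alpha>) * fps_const (fps_const \<beta>) * fps_X + sqrt_series \<alpha> * sqrt_series \<beta>"
proof -
  have "2 * fps_const (fps_const (1/2 :: complex)) = 1"
    by (simp add: mult_2)
  then show ?thesis
    unfolding explicit_solution_def by (simp flip: mult.assoc)
qed

lemma fps_const_numeral: "fps_const (numeral n) = numeral n"
  by (metis fps_numeral_fps_const)

text \<open>
  The partial derivatives of the square roots are obtained by differentiating their squares.
\<close>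

lemma formal_solution_explicit_solution: "formal_solution (explicit_solution \<alpha> \<beta>)"
proof -
  define K :: "complex \<Rightarrow> complex fps fps" where "K c = fps_const (fps_const c)" for c
  define A where "A c = fps_const (1 + fps_const c * fps_X)" for c :: complex
  have uA: "fps_deriv (A c) = 0" and zA: "fps_dz (A c) = K c" for c
    by (simp_all add: A_def K_def)
  have uK: "fps_deriv (K c) = 0" and zK: "fps_dz (K c) = 0" for c
    by (simp_all add: K_def)
  have two: "fps_dz (2 :: complex fps fps) = 0"
    by (metis fps_const_numeral fps_dz_const fps_deriv_const fps_const_0_eq_0 fps_deriv_numeral)
  have sq: "(sqrt_series c)\<^sup>2 = (A c)\<^sup>2 + 2 * (K c)\<^sup>2 * fps_X" for c
    unfolding sqrt_series_square
    by (simp add: A_def K_def power2_eq_square fps_const_mult[symmetric] fps_const_numeral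
             del: fps_const_mult)
  have u_square: "fps_deriv (G\<^sup>2) = 2 * (G * fps_deriv G)"
    and z_square: "fps_dz (G\<^sup>2) = 2 * (G * fps_dz G)" for G :: "complex fps fps"
    by (simp_all only: power2_eq_square fps_deriv_mult fps_dz_mult mult_2
          mult.commute[of "fps_deriv G" G] mult.commute[of "fps_dz G" G])
  have "2 * (sqrt_series c * fps_deriv (sqrt_series c)) = fps_deriv ((A c)\<^sup>2 + 2 * (K c)\<^sup>2 * fps_X)" for c
    by (simp only: sq[symmetric] u_square)
  then have u: "sqrt_series c * fps_deriv (sqrt_series c) = (K c)\<^sup>2" for c
    by (simp add: u_square uA uK)
  have "2 * (sqrt_series c * fps_dz (sqrt_series c)) = fps_dz ((A c)\<^sup>2 + 2 * (K c)\<^sup>2 * fps_X)" for c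
    by (simp only: sq[symmetric] z_square)
  then have z: "sqrt_series c * fps_dz (sqrt_series c) = K c * A c" for c
    by (simp add: z_square zA zK two mult.commute)
  have nz: "sqrt_series c \<noteq> 0" for c
  proof
    assume "sqrt_series c = 0"
    then have "fps_nth (fps_nth (sqrt_series c) 0) 0 = 0" by simp
    then show False by (simp add: sqrt_series_nth_0)
  qed
  have W: "2 * explicit_solution \<alpha> \<beta> =
      A \<alpha> * A \<beta> + 2 * K \<alpha> * K \<beta> * fps_X + sqrt_series \<alpha> * sqrt_series \<beta>"
    unfolding explicit_solution_double A_def K_def ..
  have Wu: "2 * fps_deriv (explicit_solution \<alpha> \<beta>) = 2 * K \<alpha> * K \<beta> +
      sqrt_series \<alpha> * fps_deriv (sqrt_series \<beta>) + fps_deriv (sqrt_series \<alpha>) * sqrt_series \<beta>"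
    using arg_cong[OF W, of fps_deriv] by (simp add: uA uK)
  have Wz: "2 * fps_dz (explicit_solution \<alpha> \<beta>) = K \<alpha> * A \<beta> + A \<alpha> * K \<beta> +
      sqrt_series \<alpha> * fps_dz (sqrt_series \<beta>) + fps_dz (sqrt_series \<alpha>) * sqrt_series \<beta>"
    using arg_cong[OF W, of fps_dz] by (simp add: zA zK two)
  show ?thesis
    unfolding formal_solution_def
    by (rule explicit_solution_algebra[OF W sq sq u u z z Wu Wz nz nz])
qed

lemma explicit_solution_nth_0:
  "fps_nth (explicit_solution \<alpha> \<beta>) 0 = (1 + fps_const \<alpha> * fps_X) * (1 + fps_const \<beta> * fps_X)"
proof -
  have "2 * fps_nth (explicit_solution \<alpha> \<beta>) 0 = fps_nth (2 * explicit_solution \<alpha> \<beta>) 0"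
    by (simp only: fps_nth_double)
  also have "\<dots> = 2 * ((1 + fps_const \<alpha> * fps_X) * (1 + fps_const \<beta> * fps_X))"
    unfolding explicit_solution_double by (simp add: sqrt_series_nth_0)
  finally show ?thesis by (simp only: mult_cancel_left) simp
qed

lemma explicit_solution_nth_nth_0:
  "2 * fps_nth (fps_nth (explicit_solution \<alpha> \<beta>) k) 0 =
     (if k = 0 then 1 else 0) + (if k = 1 then 2 * \<alpha> * \<beta> else 0) +
     (\<Sum>i=0..k. ((1 / 2 gchoose i) * (2 * \<alpha>\<^sup>2) ^ i) * ((1 / 2 gchoose (k - i)) * (2 * \<beta>\<^sup>2) ^ (k - i)))"
proof -
  have "2 * fps_nth (fps_nth (explicit_solution \<alpha> \<beta>) k) 0 = fps_nth (fps_nth (2 * explicit_solution \<alpha> \<beta>) k) 0"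
    by (simp only: fps_nth_double)
  also have "2 * explicit_solution \<alpha> \<beta> = fps_const ((1 + fps_const \<alpha> * fps_X) * (1 + fps_const \<beta> * fps_X))
       + fps_const (fps_const (2 * \<alpha> * \<beta>)) * fps_X + sqrt_series \<alpha> * sqrt_series \<beta>"
    unfolding explicit_solution_double
    by (simp add: fps_const_mult[symmetric] fps_const_numeral del: fps_const_mult)
  also have "fps_nth (fps_nth \<dots> k) 0 = 
     (if k = 0 then 1 else 0) + (if k = 1 then 2 * \<alpha> * \<beta> else 0) +
     (\<Sum>i=0..k. ((1 / 2 gchoose i) * (2 * \<alpha>\<^sup>2) ^ i) * ((1 / 2 gchoose (k - i)) * (2 * \<beta>\<^sup>2) ^ (k - i)))"
    by (simp only: fps_add_nth fps_mult_nth[of "sqrt_series \<alpha>"] fps_sum_nth fps_mult_nth_0 sqrt_series_nth_nth_0)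
       (simp add: fps_X_nth fps_nth_fps_const)
  finally show ?thesis .
qed

section \<open>From convergent to formal solutions\<close>

lemma eventually_norm_less: "r > 0 \<Longrightarrow> eventually (\<lambda>u::complex. norm u < r) (nhds 0)"
  using eventually_nhds_in_open[of "ball 0 r" "0::complex"] by simp

context
  fixes \<psi> :: "complex \<Rightarrow> complex \<Rightarrow> complex" and a :: "nat \<Rightarrow> nat \<Rightarrow> complex" and r :: real
  assumes r_pos: "r > 0"
    and expansion: "\<And>u z. norm u < r \<Longrightarrow> norm z < r \<Longrightarrow>
           ((\<lambda>(k, l). a k l * u ^ k * z ^ l) has_sum \<psi> u z) UNIV"
begin

lemma double_series_abs_summable:
  assumes "norm u < r" "norm z < r"
  shows "\<And>k. (\<lambda>l. norm (a k l * u ^ k * z ^ l)) summable_on UNIV"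
    and "(\<lambda>k. \<Sum>\<^sub>\<infinity>l. norm (a k l * u ^ k * z ^ l)) summable_on UNIV"
proof -
  have "(\<lambda>(k, l). a k l * u ^ k * z ^ l) summable_on Sigma UNIV (\<lambda>_. UNIV)"
    using expansion[OF assms] by (auto simp: summable_on_def)
  then have "(\<lambda>x. norm (case x of (k, l) \<Rightarrow> a k l * u ^ k * z ^ l)) summable_on Sigma UNIV (\<lambda>_. UNIV)"
    by (simp only: summable_on_iff_abs_summable_on_complex)
  note * = iffD1[OF Infinite_Sum.abs_summable_on_Sigma_iff this]
  have 1: "\<forall>k. (\<lambda>l. norm (a k l * u ^ k * z ^ l)) summable_on UNIV"
    using conjunct1[OF *] by simp
  have 2: "(\<lambda>k. norm (\<Sum>\<^sub>\<infinity>l. norm (a k l * u ^ k * z ^ l))) summable_on UNIV"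
    using conjunct2[OF *] by (simp only: prod.case)
  show "(\<lambda>l. norm (a k l * u ^ k * z ^ l)) summable_on UNIV" for k
    using 1 by simp
  show "(\<lambda>k. \<Sum>\<^sub>\<infinity>l. norm (a k l * u ^ k * z ^ l)) summable_on UNIV"
    using 2 summable_on_iff_abs_summable_on_real by blast
qed

lemma row_conv_radius: "fps_conv_radius (Abs_fps (a k)) \<ge> ereal r"
  unfolding fps_conv_radius_def
proof (rule conv_radius_geI_ex')
  fix s :: real assume s: "0 < s" "ereal s < ereal r"
  define u :: complex where "u = of_real (r / 2)"
  have u: "norm u < r" "u \<noteq> 0" using r_pos by (auto simp: u_def)
  have "(\<lambda>l. a k l * u ^ k * of_real s ^ l) summable_on UNIV"
    by (rule abs_summable_summable, rule double_series_abs_summable) (use s u in auto)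
  then have "summable (\<lambda>l. a k l * u ^ k * of_real s ^ l)"
    by (rule summable_on_imp_summable)
  then have "summable (\<lambda>l. inverse (u ^ k) * (a k l * u ^ k * of_real s ^ l))"
    by (rule summable_mult)
  moreover have "(\<lambda>l. inverse (u ^ k) * (a k l * u ^ k * of_real s ^ l)) = (\<lambda>l. a k l * of_real s ^ l)"
    using u(2) by (simp add: fun_eq_iff field_simps)
  ultimately show "summable (\<lambda>n. fps_nth (Abs_fps (a k)) n * of_real s ^ n)"
    by simp
qed

lemma norm_less_row_conv_radius: "norm z < r \<Longrightarrow> ereal (norm z) < fps_conv_radius (Abs_fps (a k))"
  using row_conv_radius[of k] by (meson ereal_less_eq(3) less_le_trans less_ereal.simps(1))

lemma row_has_sum:
  assumes "norm u < r" "norm z < r"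
  shows "((\<lambda>l. a k l * u ^ k * z ^ l) has_sum eval_fps (Abs_fps (a k)) z * u ^ k) UNIV"
proof -
  obtain s where s: "((\<lambda>l. a k l * u ^ k * z ^ l) has_sum s) UNIV"
    using abs_summable_summable[OF double_series_abs_summable(1)[OF assms, of k]]
    by (auto simp: summable_on_def)
  have "(\<lambda>l. fps_nth (Abs_fps (a k)) l * z ^ l * u ^ k) sums (eval_fps (Abs_fps (a k)) z * u ^ k)"
    by (intro sums_mult2 sums_eval_fps norm_less_row_conv_radius assms)
  then have "s = eval_fps (Abs_fps (a k)) z * u ^ k"
    using has_sum_imp_sums[OF s] by (simp add: sums_unique2 mult_ac)
  with s show ?thesis by simp
qed

lemma iterated_sums:
  assumes "norm u < r" "norm z < r"
  shows "(\<lambda>k. eval_fps (Abs_fps (a k)) z * u ^ k) sums \<psi> u z"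
proof (rule has_sum_imp_sums, rule has_sum_SigmaD)
  show "((\<lambda>(k, l). a k l * u ^ k * z ^ l) has_sum \<psi> u z) (Sigma UNIV (\<lambda>_. UNIV))"
    using expansion[OF assms] by simp
qed (use row_has_sum[OF assms] in simp)

text \<open>
  Termwise differentiation by \<open>z\<close> of the \<open>u\<close>-expansion is allowed by Weierstrass: on a disc
  \<open>|w| < \<rho>\<close> containing \<open>z\<close>, the \<open>k\<close>-th term is bounded by the sum over \<open>l\<close> of
  \<open>|a\<^sub>k\<^sub>l u\<^sup>k \<rho>\<^sup>l|\<close>, and these bounds are summable over \<open>k\<close> since the double series converges absolutely
  at \<open>(u,\<rho>)\<close>.
\<close>

lemma iterated_sums_pd_z:
  assumes u: "norm u < r" and z: "norm z < r"
  shows "(\<lambda>k. eval_fps (fps_deriv (Abs_fps (a k))) z * u ^ k) sums pd_z \<psi> u z"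
proof -
  define \<rho> where "\<rho> = (norm z + r) / 2"
  have \<rho>: "norm z < \<rho>" "\<rho> < r" "0 < \<rho>" using z r_pos norm_ge_zero[of z] by (auto simp: \<rho>_def simp del: norm_ge_zero)
  then have \<rho>': "norm (of_real \<rho> :: complex) < r" by simp
  define h where "h k = (\<Sum>\<^sub>\<infinity>l. norm (a k l * u ^ k * of_real \<rho> ^ l))" for k
  have "summable h"
    unfolding h_def by (rule summable_on_imp_summable, rule double_series_abs_summable(2)[OF u \<rho>'])
  moreover have "((\<lambda>z. eval_fps (Abs_fps (a k)) z * u ^ k) has_field_derivative
      eval_fps (fps_deriv (Abs_fps (a k))) w * u ^ k) (at w)" if "w \<in> ball 0 \<rho>" for k w
    by (intro DERIV_cmult_right has_field_derivative_eval_fps norm_less_row_conv_radius)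
       (use that \<rho> in auto)
  moreover have "norm (eval_fps (Abs_fps (a k)) w * u ^ k) \<le> h k" if "w \<in> ball 0 \<rho>" for k w
  proof -
    have w: "norm w < r" "norm w \<le> \<rho>" using that \<rho> by auto
    have "norm (eval_fps (Abs_fps (a k)) w * u ^ k) = norm (\<Sum>\<^sub>\<infinity>l. a k l * u ^ k * w ^ l)"
      using infsumI[OF row_has_sum[OF u w(1), of k]] by simp
    also have "\<dots> \<le> (\<Sum>\<^sub>\<infinity>l. norm (a k l * u ^ k * w ^ l))"
      by (rule norm_infsum_bound[OF double_series_abs_summable(1)[OF u w(1)]])
    also have "\<dots> \<le> h k"
      unfolding h_def
      by (rule infsum_mono[OF double_series_abs_summable(1)[OF u w(1)]
            double_series_abs_summable(1)[OF u \<rho>']])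
         (use w(2) \<rho>(3) in \<open>auto simp: norm_mult norm_power intro!: mult_left_mono power_mono\<close>)
    finally show ?thesis .
  qed
  ultimately obtain g g' where g: "\<forall>w\<in>ball 0 \<rho>.
      (\<lambda>k. eval_fps (Abs_fps (a k)) w * u ^ k) sums g w \<and>
      (\<lambda>k. eval_fps (fps_deriv (Abs_fps (a k))) w * u ^ k) sums g' w \<and>
      (g has_field_derivative g' w) (at w)"
    by (rule_tac series_and_derivative_comparison[of "ball 0 \<rho>" h
          "\<lambda>k w. eval_fps (Abs_fps (a k)) w * u ^ k"
          "\<lambda>k w. eval_fps (fps_deriv (Abs_fps (a k))) w * u ^ k"]) auto
  have z\<rho>: "z \<in> ball 0 \<rho>" using \<rho> by simp
  have "(\<psi> u has_field_derivative g' z) (at z)"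
  proof (rule has_field_derivative_transform_within_open)
    show "(g has_field_derivative g' z) (at z)" using g z\<rho> by blast
    show "g w = \<psi> u w" if "w \<in> ball 0 \<rho>" for w
      using g that iterated_sums[OF u, of w] \<rho> by (auto intro: sums_unique2)
  qed (use z\<rho> in auto)
  then have "pd_z \<psi> u z = g' z" unfolding pd_z_def by (rule DERIV_imp_deriv)
  then show ?thesis using g z\<rho> by auto
qed

lemma fps_expansion_solution:
  assumes "norm z < r"
  shows "(\<lambda>u. \<psi> u z) has_fps_expansion Abs_fps (\<lambda>k. eval_fps (Abs_fps (a k)) z)"
  by (rule has_fps_expansionI, rule eventually_mono[OF eventually_norm_less[OF r_pos]])
     (use iterated_sums assms in simp)

lemma fps_expansion_pd_u:
  assumes "norm z < r"
  shows "(\<lambda>u. pd_u \<psi> u z) has_fps_expansion fps_deriv (Abs_fps (\<lambda>k. eval_fps (Abs_fps (a k)) z))"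
  using has_fps_expansion_deriv[OF fps_expansion_solution[OF assms]] by (simp add: pd_u_def)

lemma fps_expansion_pd_z:
  assumes "norm z < r"
  shows "(\<lambda>u. pd_z \<psi> u z) has_fps_expansion Abs_fps (\<lambda>k. eval_fps (fps_deriv (Abs_fps (a k))) z)"
  by (rule has_fps_expansionI, rule eventually_mono[OF eventually_norm_less[OF r_pos]])
     (use iterated_sums_pd_z assms in simp)

end

lemma has_fps_expansion_eq_0:
  fixes f :: "complex \<Rightarrow> complex"
  assumes "f has_fps_expansion F" and "eventually (\<lambda>x. f x = 0) (nhds 0)"
  shows "F = 0"
proof -
  have "(\<lambda>_. 0) has_fps_expansion F"
    using assms has_fps_expansion_cong[of f "\<lambda>_. 0" F F] by simp
  then show ?thesis
    by (intro fps_ext) (simp add: fps_nth_fps_expansion)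
qed

text \<open>
  A family \<open>S z\<close> of power series in \<open>u\<close>, each of whose coefficients is an analytic function of \<open>z\<close>
  near \<open>0\<close>, with Taylor series collected in \<open>F\<close>.  This is the bridge between functions and iterated
  power series; it is compatible with the ring operations and with differentiation by \<open>u\<close>.
\<close>

definition coefficientwise_expansion :: "(complex \<Rightarrow> complex fps) \<Rightarrow> complex fps fps \<Rightarrow> bool" where
  "coefficientwise_expansion S F \<longleftrightarrow> (\<forall>n. (\<lambda>z. fps_nth (S z) n) has_fps_expansion fps_nth F n)"

lemma coefficientwise_expansion_add:
  "coefficientwise_expansion S F \<Longrightarrow> coefficientwise_expansion T G \<Longrightarrow>
   coefficientwise_expansion (\<lambda>z. S z + T z) (F + G)"
  by (auto simp: coefficientwise_expansion_def intro: has_fps_expansion_add)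

lemma coefficientwise_expansion_diff:
  "coefficientwise_expansion S F \<Longrightarrow> coefficientwise_expansion T G \<Longrightarrow>
   coefficientwise_expansion (\<lambda>z. S z - T z) (F - G)"
  by (auto simp: coefficientwise_expansion_def intro: has_fps_expansion_diff)

lemma coefficientwise_expansion_mult:
  "coefficientwise_expansion S F \<Longrightarrow> coefficientwise_expansion T G \<Longrightarrow>
   coefficientwise_expansion (\<lambda>z. S z * T z) (F * G)"
  unfolding coefficientwise_expansion_def fps_mult_nth
  by (intro allI has_fps_expansion_sum has_fps_expansion_mult) auto

lemma coefficientwise_expansion_X: "coefficientwise_expansion (\<lambda>z. fps_X) fps_X"
  by (auto simp: coefficientwise_expansion_def fps_X_nth)

lemma coefficientwise_expansion_deriv:
  assumes "coefficientwise_expansion S F"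
  shows "coefficientwise_expansion (\<lambda>z. fps_deriv (S z)) (fps_deriv F)"
  unfolding coefficientwise_expansion_def
proof
  fix n
  show "(\<lambda>z. fps_nth (fps_deriv (S z)) n) has_fps_expansion fps_nth (fps_deriv F) n"
    using has_fps_expansion_cmult_left[of "\<lambda>z. fps_nth (S z) (n+1)" "fps_nth F (n+1)" "of_nat (n+1)"] assms
    by (simp add: coefficientwise_expansion_def fps_of_nat del: of_nat_Suc)
qed

text \<open>
  Coefficients are compared twice.  For fixed \<open>z\<close> the equation holds for the functions of \<open>u\<close>, hence
  for their power series in \<open>u\<close>; so each coefficient of the residual, a function of \<open>z\<close>, vanishes
  near \<open>0\<close>, and therefore its own power series is zero.
\<close>

lemma formal_solution_of_analytic_solution:
  assumes r: "r > 0"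
    and expansion: "\<And>u z. norm u < r \<Longrightarrow> norm z < r \<Longrightarrow>
           ((\<lambda>(k, l). a k l * u ^ k * z ^ l) has_sum \<psi> u z) UNIV"
    and pde: "\<And>u z. norm u < r \<Longrightarrow> norm z < r \<Longrightarrow>
           - \<psi> u z * pd_u \<psi> u z + u * (pd_u \<psi> u z)\<^sup>2 + 1 / 2 * (pd_z \<psi> u z)\<^sup>2 = 0"
  shows "formal_solution (Abs_fps (\<lambda>k. Abs_fps (a k)))"
proof -
  note facts = r expansion
  define F where "F = Abs_fps (\<lambda>k. Abs_fps (a k))"
  define S where "S z = Abs_fps (\<lambda>k. eval_fps (Abs_fps (a k)) z)" for z
  define T where "T z = Abs_fps (\<lambda>k. eval_fps (fps_deriv (Abs_fps (a k))) z)" for z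
  have pos: "fps_conv_radius (Abs_fps (a k)) > 0" for k
    using less_le_trans[OF _ row_conv_radius[of r a \<psi> k, OF facts], of 0] r by (simp add: zero_ereal_def)
  have S: "coefficientwise_expansion S F"
    using pos by (auto simp: coefficientwise_expansion_def S_def F_def intro: eval_fps_has_fps_expansion)
  have T: "coefficientwise_expansion T (fps_dz F)"
    unfolding coefficientwise_expansion_def T_def F_def
    using less_le_trans[OF pos fps_conv_radius_deriv] by (auto intro: eval_fps_has_fps_expansion)
  \<comment> \<open>Doubling is written as a sum because the rules for \<open>coefficientwise_expansion\<close> treat sums and products.\<close>
  define Res where "Res z = (S z + S z) * fps_deriv (S z)
      - ((fps_X + fps_X) * (fps_deriv (S z) * fps_deriv (S z)) + T z * T z)" for z
  have zero: "Res z = 0" if z: "norm z < r" for z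
  proof (rule has_fps_expansion_eq_0)
    show "(\<lambda>u. (\<psi> u z + \<psi> u z) * pd_u \<psi> u z -
        ((u + u) * (pd_u \<psi> u z * pd_u \<psi> u z) + pd_z \<psi> u z * pd_z \<psi> u z)) has_fps_expansion Res z"
      unfolding Res_def S_def T_def
      by (intro fps_expansion_intros has_fps_expansion_fps_X fps_expansion_solution[of r a \<psi>]
          fps_expansion_pd_u[of r a \<psi>] fps_expansion_pd_z[of r a \<psi>] facts z)
    show "\<forall>\<^sub>F u in nhds 0. (\<psi> u z + \<psi> u z) * pd_u \<psi> u z -
        ((u + u) * (pd_u \<psi> u z * pd_u \<psi> u z) + pd_z \<psi> u z * pd_z \<psi> u z) = 0"
      using eventually_norm_less[OF r]
    proof eventually_elim
      case (elim u)
      show ?case using pde[OF elim z] by (simp add: power2_eq_square field_simps)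
    qed
  qed
  have "coefficientwise_expansion Res ((F + F) * fps_deriv F
      - ((fps_X + fps_X) * (fps_deriv F * fps_deriv F) + fps_dz F * fps_dz F))"
    unfolding Res_def
    by (intro coefficientwise_expansion_add coefficientwise_expansion_diff coefficientwise_expansion_mult
        coefficientwise_expansion_deriv coefficientwise_expansion_X S T)
  note expansions = this[unfolded coefficientwise_expansion_def, rule_format]
  have "fps_nth ((F + F) * fps_deriv F
      - ((fps_X + fps_X) * (fps_deriv F * fps_deriv F) + fps_dz F * fps_dz F)) n = 0" for n
    by (rule has_fps_expansion_eq_0[OF expansions], rule eventually_mono[OF eventually_norm_less[OF r]])
       (simp add: zero)
  then have "(F + F) * fps_deriv F
      - ((fps_X + fps_X) * (fps_deriv F * fps_deriv F) + fps_dz F * fps_dz F) = 0"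
    by (intro fps_ext) simp
  then show ?thesis
    by (simp only: formal_solution_def F_def[symmetric] power2_eq_square mult_2 right_minus_eq)
qed

section \<open>The coefficients of the square root at z = 0\<close>

text \<open>
  The power \<open>(1 + xu)\<^sup>c\<close> for a complex number \<open>x\<close>.
\<close>

definition scaled_binomial :: "complex \<Rightarrow> complex \<Rightarrow> complex fps" where
  "scaled_binomial c x = Abs_fps (\<lambda>n. (c gchoose n) * x ^ n)"

lemma scaled_binomial_nth [simp]: "fps_nth (scaled_binomial c x) n = (c gchoose n) * x ^ n"
  by (simp add: scaled_binomial_def)

lemma scaled_binomial_compose: "scaled_binomial c x = fps_compose (fps_binomial c) (fps_const x * fps_X)"
  unfolding fps_compose_linear scaled_binomial_def by (simp add: mult.commute)

lemma scaled_binomial_mult: "scaled_binomial c x * scaled_binomial d x = scaled_binomial (c + d) x"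
  by (simp add: scaled_binomial_compose fps_binomial_add_mult fps_compose_mult_distrib)

lemma scaled_binomial_1: "scaled_binomial 1 x = 1 + fps_const x * fps_X"
  by (simp add: scaled_binomial_compose fps_binomial_1 fps_compose_add_distrib)

lemma scaled_binomial_deriv:
  "fps_deriv (scaled_binomial (c + 1) x) = fps_const ((c + 1) * x) * scaled_binomial c x"
proof (rule fps_ext)
  fix n
  have "fps_nth (fps_deriv (scaled_binomial (c + 1) x)) n =
      (of_nat (Suc n) * ((c + 1) gchoose (Suc n))) * x ^ Suc n"
    by (simp del: of_nat_Suc)
  also have "\<dots> = fps_nth (fps_const ((c + 1) * x) * scaled_binomial c x) n"
    unfolding Suc_times_gbinomial by (simp add: mult_ac)
  finally show "fps_nth (fps_deriv (scaled_binomial (c + 1) x)) n =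
      fps_nth (fps_const ((c + 1) * x) * scaled_binomial c x) n" .
qed

text \<open>
  With \<open>p x = 1 + 2xu\<close> and \<open>h x\<close> its power with exponent \<open>-3/2\<close>, the powers with exponents \<open>1/2\<close> and
  \<open>-1/2\<close> are \<open>p\<^sup>2h\<close> and \<open>ph\<close>.  Hence all terms of the product rule have the common factor
  \<open>h A \<cdot> h B\<close>, and the other factor is \<open>-(A p B - B p A)\<^sup>2\<close>, in which \<open>u\<close> cancels.
\<close>

lemma second_deriv_sqrt_product:
  fixes A B :: complex
  shows "fps_deriv (fps_deriv (scaled_binomial (1 / 2) (2 * A) * scaled_binomial (1 / 2) (2 * B))) =
     - (fps_const ((A - B)\<^sup>2) * (scaled_binomial (-3 / 2) (2 * A) * scaled_binomial (-3 / 2) (2 * B)))"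
proof -
  define h where "h x = scaled_binomial (-3 / 2) (2 * x)" for x
  define p where "p x = 1 + fps_const (2 * x) * fps_X" for x :: complex
  have m: "scaled_binomial (-1 / 2) (2 * x) = p x * h x" for x
    using scaled_binomial_mult[of 1 "2 * x" "-3/2"] by (simp add: h_def p_def scaled_binomial_1)
  have p: "scaled_binomial (1 / 2) (2 * x) = p x * (p x * h x)" for x
    using scaled_binomial_mult[of 1 "2 * x" "-1/2"] unfolding m by (simp add: p_def scaled_binomial_1)
  have d1: "fps_deriv (scaled_binomial (1 / 2) (2 * x)) = fps_const x * (p x * h x)" for x
    using scaled_binomial_deriv[of "-1/2" "2 * x"] unfolding m by simp
  have d2: "fps_deriv (p x * h x) = - (fps_const x * h x)" for x
  proof -
    have "(-3 / 2 :: complex) + 1 = -1 / 2" by simp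
    then have "fps_deriv (p x * h x) = fps_const ((-1 / 2) * (2 * x)) * h x"
      using scaled_binomial_deriv[of "-3/2" "2 * x"] unfolding h_def by (simp only: m h_def)
    then show ?thesis by (simp flip: fps_const_neg)
  qed
  have d3: "fps_deriv (fps_deriv (scaled_binomial (1 / 2) (2 * x))) = - (fps_const x * (fps_const x * h x))" for x
    unfolding d1 fps_deriv_mult_const_left d2 by simp
  have leibniz: "fps_deriv (fps_deriv (f * g)) =
      f * fps_deriv (fps_deriv g) + 2 * (fps_deriv f * fps_deriv g) + fps_deriv (fps_deriv f) * g"
    for f g :: "complex fps"
    by (simp add: algebra_simps)
  have "fps_deriv (fps_deriv (scaled_binomial (1 / 2) (2 * A) * scaled_binomial (1 / 2) (2 * B))) =
    - (h A * h B * (fps_const A * p B - fps_const B * p A)\<^sup>2)"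
    unfolding leibniz unfolding d3 unfolding d1 unfolding p
    by (simp add: power2_eq_square algebra_simps del: fps_const_mult)
  also have "fps_const A * p B - fps_const B * p A = fps_const (A - B)"
    by (simp add: p_def algebra_simps flip: fps_const_sub)
  finally show ?thesis by (simp add: h_def power2_eq_square mult_ac)
qed

lemma sqrt_product_coeff:
  fixes A B :: complex
  shows "(\<Sum>i=0..n+2. ((1 / 2 gchoose i) * (2 * A) ^ i) * ((1 / 2 gchoose (n + 2 - i)) * (2 * B) ^ (n + 2 - i))) =
    - ((A - B)\<^sup>2 / (of_nat (n + 1) * of_nat (n + 2))) *
      (\<Sum>i=0..n. ((-3 / 2 gchoose i) * (2 * A) ^ i) * ((-3 / 2 gchoose (n - i)) * (2 * B) ^ (n - i)))"
proof -
  have "of_nat (n + 1) * (of_nat (n + 2) *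
      fps_nth (scaled_binomial (1 / 2) (2 * A) * scaled_binomial (1 / 2) (2 * B)) (n + 2)) =
    - ((A - B)\<^sup>2 * fps_nth (scaled_binomial (-3 / 2) (2 * A) * scaled_binomial (-3 / 2) (2 * B)) n)"
    using arg_cong[OF second_deriv_sqrt_product[of A B], of "\<lambda>f. fps_nth f n"]
    by (simp only: fps_deriv_nth fps_neg_nth fps_mult_left_const_nth) simp
  moreover have "of_nat (n + 1) \<noteq> (0 :: complex)" "of_nat (n + 2) \<noteq> (0 :: complex)"
    by (simp_all only: of_nat_eq_0_iff)
  ultimately have "fps_nth (scaled_binomial (1 / 2) (2 * A) * scaled_binomial (1 / 2) (2 * B)) (n + 2) =
    - ((A - B)\<^sup>2 / (of_nat (n + 1) * of_nat (n + 2))) *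
      fps_nth (scaled_binomial (-3 / 2) (2 * A) * scaled_binomial (-3 / 2) (2 * B)) n"
    by (simp add: divide_simps mult_ac del: of_nat_add)
  then show ?thesis
    by (simp only: fps_mult_nth scaled_binomial_nth)
qed

text \<open>
  The coefficients of the power of \<open>1 - 4x\<close> with exponent \<open>-3/2\<close>; the weights in \<open>Q\<close> are products
  of two of them.
\<close>

definition three_halves_coeff :: "nat \<Rightarrow> complex" where
  "three_halves_coeff i = fact (2 * i + 1) / (fact i)\<^sup>2"

lemma gbinomial_minus_three_halves: "(-3 / 2 :: complex) gchoose n = (-1 / 4) ^ n * three_halves_coeff n"
proof (induction n)
  case (Suc n)
  have "of_nat (Suc n) * ((-3 / 2 :: complex) gchoose (Suc n)) = (-3 / 2 - of_nat n) * ((-3 / 2) gchoose n)"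
    using gbinomial_mult_1[of "-3 / 2 :: complex" n] by (simp add: algebra_simps)
  also have "\<dots> = of_nat (Suc n) * ((-1 / 4) ^ Suc n * three_halves_coeff (Suc n))"
  proof -
    have "three_halves_coeff (Suc n) = of_nat (2 * n + 3) * (of_nat (2 * n + 2) * fact (2 * n + 1)) / (of_nat (Suc n) * fact n)\<^sup>2"
      unfolding three_halves_coeff_def by (simp add: fact_reduce mult.assoc)
    also have "\<dots> = 2 * of_nat (2 * n + 3) / of_nat (Suc n) * three_halves_coeff n"
      by (simp add: three_halves_coeff_def power2_eq_square divide_simps del: of_nat_Suc fact_Suc)
         (simp add: algebra_simps)
    finally have "of_nat (Suc n) * three_halves_coeff (Suc n) = 2 * of_nat (2 * n + 3) * three_halves_coeff n"
      by (simp del: of_nat_Suc)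
    then have "of_nat (Suc n) * ((-1 / 4) ^ Suc n * three_halves_coeff (Suc n)) = (-1 / 4) ^ Suc n * (2 * of_nat (2 * n + 3) * three_halves_coeff n)"
      by (metis mult.left_commute)
    then show ?thesis unfolding Suc by (simp add: algebra_simps)
  qed
  finally show ?case by (simp del: of_nat_Suc power_Suc)
qed (simp add: three_halves_coeff_def)

lemma Q_eq: "Q (n + 2) \<alpha> \<beta> =
    fact n / 2 ^ n * (\<Sum>i=0..n. three_halves_coeff i * three_halves_coeff (n - i) * \<alpha> ^ (2 * (n - i)) * \<beta> ^ (2 * i))"
proof -
  have "(\<Sum>j = 1..n+2 - 1. fact (2 * j - 1) * fact (2 * (n+2) - 2 * j - 1) /
        ((fact (j - 1))\<^sup>2 * (fact (n+2 - j - 1))\<^sup>2) *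
        \<alpha> ^ (2 * (n+2) - 2 * j - 2) * \<beta> ^ (2 * j - 2)) =
     (\<Sum>i=0..n. three_halves_coeff i * three_halves_coeff (n - i) * \<alpha> ^ (2 * (n - i)) * \<beta> ^ (2 * i))"
  proof (rule sum.reindex_bij_witness[of _ "\<lambda>i. i + 1" "\<lambda>j. j - 1"])
    fix j assume j: "j \<in> {1..n + 2 - 1}"
    then obtain i where i: "j = i + 1" "i \<le> n"
      by (metis add_diff_cancel_right' atLeastAtMost_iff le_add_diff_inverse2 le_diff_conv nat_1_add_1 add.assoc)
    have e: "2 * j - 1 = 2 * i + 1" "2 * (n+2) - 2 * j - 1 = 2 * (n - i) + 1" "j - 1 = i"
       "n + 2 - j - 1 = n - i" "2 * (n+2) - 2 * j - 2 = 2 * (n - i)" "2 * j - 2 = 2 * i"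
      using i by auto
    show "three_halves_coeff (j - 1) * three_halves_coeff (n - (j - 1)) * \<alpha> ^ (2 * (n - (j - 1))) * \<beta> ^ (2 * (j - 1)) =
       fact (2 * j - 1) * fact (2 * (n+2) - 2 * j - 1) /
        ((fact (j - 1))\<^sup>2 * (fact (n+2 - j - 1))\<^sup>2) *
        \<alpha> ^ (2 * (n+2) - 2 * j - 2) * \<beta> ^ (2 * j - 2)"
      unfolding e three_halves_coeff_def by simp
  qed auto
  then show ?thesis unfolding Q_def by simp
qed

lemma sqrt_product_coeff_Q:
  "(\<Sum>i=0..n+2. ((1 / 2 gchoose i) * (2 * \<alpha>\<^sup>2) ^ i) * ((1 / 2 gchoose (n + 2 - i)) * (2 * \<beta>\<^sup>2) ^ (n + 2 - i))) =
    (-1) ^ (n + 3) / fact (n + 2) * (\<alpha> - \<beta>)\<^sup>2 * (\<alpha> + \<beta>)\<^sup>2 * Q (n + 2) \<alpha> \<beta>"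
proof -
  have "(\<Sum>i=0..n. ((-3 / 2 gchoose i) * (2 * \<alpha>\<^sup>2) ^ i) * ((-3 / 2 gchoose (n - i)) * (2 * \<beta>\<^sup>2) ^ (n - i))) =
     (\<Sum>i=0..n. (-1 / 2) ^ n * (three_halves_coeff i * three_halves_coeff (n - i) * \<alpha> ^ (2 * i) * \<beta> ^ (2 * (n - i))))"
  proof (rule sum.cong[OF refl])
    fix i assume "i \<in> {0..n}"
    then have n: "(-1 / 2 :: complex) ^ n = (-1 / 2) ^ i * (-1 / 2) ^ (n - i)"
      by (simp flip: power_add)
    have h: "(-3 / 2 gchoose j) * (2 * x\<^sup>2) ^ j = (-1 / 2) ^ j * (three_halves_coeff j * x ^ (2 * j))" for j and x :: complex
    proof -
      have "(-1 / 4) ^ j * (2 * x\<^sup>2) ^ j = (-1 / 4 * (2 * x\<^sup>2)) ^ j"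
        by (simp only: power_mult_distrib)
      also have "-1 / 4 * (2 * x\<^sup>2) = -1 / 2 * x\<^sup>2" by simp
      also have "\<dots> ^ j = (-1 / 2) ^ j * x ^ (2 * j)"
        by (simp only: power_mult_distrib power_mult)
      finally have "(-1 / 4) ^ j * (2 * x\<^sup>2) ^ j = (-1 / 2) ^ j * x ^ (2 * j)" .
      then show ?thesis unfolding gbinomial_minus_three_halves by (simp add: mult_ac)
    qed
    show "(-3 / 2 gchoose i) * (2 * \<alpha>\<^sup>2) ^ i * ((-3 / 2 gchoose (n - i)) * (2 * \<beta>\<^sup>2) ^ (n - i)) =
      (-1 / 2) ^ n * (three_halves_coeff i * three_halves_coeff (n - i) * \<alpha> ^ (2 * i) * \<beta> ^ (2 * (n - i)))"
      unfolding h n by (simp only: mult_ac)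
  qed
  also have "\<dots> = (-1 / 2) ^ n * (\<Sum>i=0..n. three_halves_coeff i * three_halves_coeff (n - i) * \<alpha> ^ (2 * (n - i)) * \<beta> ^ (2 * i))"
    unfolding sum_distrib_left
    by (rule sum.reindex_bij_witness[of _ "\<lambda>i. n - i" "\<lambda>i. n - i"]) (auto simp: mult_ac)
  also have "\<dots> = (-1) ^ n / fact n * Q (n + 2) \<alpha> \<beta>"
    unfolding Q_eq power_divide by simp
  finally have S: "(\<Sum>i=0..n. ((-3 / 2 gchoose i) * (2 * \<alpha>\<^sup>2) ^ i) * ((-3 / 2 gchoose (n - i)) * (2 * \<beta>\<^sup>2) ^ (n - i))) =
      (-1) ^ n / fact n * Q (n + 2) \<alpha> \<beta>" .
  have f: "(fact (n + 2) :: complex) = of_nat (n + 1) * of_nat (n + 2) * fact n"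
    by (simp add: fact_reduce mult_ac)
  have "(\<alpha>\<^sup>2 - \<beta>\<^sup>2)\<^sup>2 = (\<alpha> - \<beta>)\<^sup>2 * (\<alpha> + \<beta>)\<^sup>2"
    by (simp add: power2_eq_square algebra_simps)
  moreover have "(-1 :: complex) ^ (n + 3) = - ((-1) ^ n)"
    by (simp add: power_add)
  ultimately show ?thesis
    unfolding sqrt_product_coeff S f by (simp add: mult_ac del: of_nat_add power_Suc)
qed

section \<open>Properties of the polynomials Q\<close>

text \<open>
  Squaring the power with exponent \<open>-3/2\<close> gives the power with exponent \<open>-3\<close>, whose coefficients
  are, up to sign and scaling, binomial coefficients.
\<close>

lemma three_halves_coeff_convolution_sum: "(\<Sum>i=0..n. three_halves_coeff i * three_halves_coeff (n - i)) = 4 ^ n * (of_nat (n + 1) * of_nat (n + 2) / 2)"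
proof -
  have "(-1 / 4) ^ n * (\<Sum>i=0..n. three_halves_coeff i * three_halves_coeff (n - i)) =
      (\<Sum>i=0..n. ((-3 / 2) gchoose i) * ((-3 / 2) gchoose (n - i)))"
    unfolding gbinomial_minus_three_halves sum_distrib_left
  proof (rule sum.cong[OF refl])
    fix i assume "i \<in> {0..n}"
    then have n: "(-1 / 4 :: complex) ^ n = (-1 / 4) ^ i * (-1 / 4) ^ (n - i)"
      by (simp flip: power_add)
    show "(-1 / 4) ^ n * (three_halves_coeff i * three_halves_coeff (n - i)) = (-1 / 4) ^ i * three_halves_coeff i * ((-1 / 4) ^ (n - i) * three_halves_coeff (n - i))"
      unfolding n by (simp only: mult_ac)
  qed
  also have "\<dots> = (-3) gchoose n"
    by (simp add: gbinomial_Vandermonde)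
  also have "\<dots> = (-1) ^ n * (of_nat (n + 2) gchoose n)"
    using gbinomial_minus[of "3 :: complex" n] by (simp add: add.commute)
  also have "(of_nat (n + 2) gchoose n :: complex) = of_nat ((n + 2) choose 2)"
    using binomial_symmetric[of 2 "n + 2"] binomial_gbinomial[of "n + 2" n, where 'a = complex] by simp
  also have "(of_nat ((n + 2) choose 2) :: complex) = of_nat (n + 1) * of_nat (n + 2) / 2"
  proof -
    have "2 * ((n + 2) choose 2) = (n + 1) * (n + 2)"
      by (simp add: choose_two)
    from arg_cong[OF this, of "of_nat :: nat \<Rightarrow> complex"] show ?thesis
      by (simp only: of_nat_mult of_nat_numeral) (simp add: mult.commute)
  qed
  finally have *: "(-1 / 4) ^ n * (\<Sum>i=0..n. three_halves_coeff i * three_halves_coeff (n - i)) = (-1) ^ n * (of_nat (n + 1) * of_nat (n + 2) / 2)" .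
  have "(\<Sum>i=0..n. three_halves_coeff i * three_halves_coeff (n - i)) = (-4) ^ n * ((-1 / 4) ^ n * (\<Sum>i=0..n. three_halves_coeff i * three_halves_coeff (n - i)))"
    by (simp flip: mult.assoc power_mult_distrib)
  also have "\<dots> = 4 ^ n * (of_nat (n + 1) * of_nat (n + 2) / 2)"
    unfolding * by (simp only: mult.assoc[symmetric] power_mult_distrib[symmetric]) simp
  finally show ?thesis .
qed

definition Q_poly :: "nat \<Rightarrow> complex poly poly" where
  "Q_poly n = (\<Sum>i=0..n. monom (monom (fact n / 2 ^ n * (three_halves_coeff i * three_halves_coeff (n - i))) (2 * (n - i))) (2 * i))"

lemma eval2_Q_poly: "eval2 (Q_poly n) x y = Q (n + 2) x y"
  unfolding eval2_def Q_poly_def Q_eq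
  by (simp add: poly_sum poly_monom sum_distrib_left mult_ac poly_const_pow)

lemma coeff2_Q_poly: "coeff2 (Q_poly n) k l =
   (\<Sum>i=0..n. if k = 2 * (n - i) \<and> l = 2 * i then fact n / 2 ^ n * (three_halves_coeff i * three_halves_coeff (n - i)) else 0)"
  unfolding coeff2_def Q_poly_def by (auto simp: coeff_sum intro!: sum.cong)

lemma symmetric2_Q_poly: "symmetric2 (Q_poly n)"
  unfolding symmetric2_def coeff2_Q_poly
proof (intro allI)
  fix k l
  show "(\<Sum>i=0..n. if k = 2 * (n - i) \<and> l = 2 * i then fact n / 2 ^ n * (three_halves_coeff i * three_halves_coeff (n - i)) else 0) =
        (\<Sum>i=0..n. if l = 2 * (n - i) \<and> k = 2 * i then fact n / 2 ^ n * (three_halves_coeff i * three_halves_coeff (n - i)) else 0)"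
    by (rule sum.reindex_bij_witness[of _ "\<lambda>i. n - i" "\<lambda>i. n - i"]) (auto simp: mult_ac)
qed

lemma homogeneous2_Q_poly: "homogeneous2 (2 * n) (Q_poly n)"
  unfolding homogeneous2_def
proof (intro allI impI)
  fix k l assume "coeff2 (Q_poly n) k l \<noteq> 0"
  then obtain i where "i \<in> {0..n}"
      "(if k = 2 * (n - i) \<and> l = 2 * i then fact n / 2 ^ n * (three_halves_coeff i * three_halves_coeff (n - i)) else 0) \<noteq> 0"
    unfolding coeff2_Q_poly by (rule sum.not_neutral_contains_not_neutral)
  then show "k + l = 2 * n" by (auto split: if_splits)
qed

text \<open>
  For \<open>k = n + 2\<close> the factor \<open>2\<^sup>n/2\<close> is \<open>2\<^sup>k\<^sup>-\<^sup>3\<close>, whose exponent is negative when \<open>k = 2\<close>.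
\<close>

lemma coeff_sum_Q_poly:
  "(\<Sum>i=0..n. coeff2 (Q_poly n) (2 * (n - i)) (2 * i)) = 2 ^ n / 2 * fact (n + 2)"
proof -
  have "(\<Sum>i=0..n. coeff2 (Q_poly n) (2 * (n - i)) (2 * i)) = (\<Sum>i=0..n. fact n / 2 ^ n * (three_halves_coeff i * three_halves_coeff (n - i)))"
  proof (rule sum.cong[OF refl])
    fix i assume i: "i \<in> {0..n}"
    have "coeff2 (Q_poly n) (2 * (n - i)) (2 * i) =
       (\<Sum>j=0..n. if j = i then fact n / 2 ^ n * (three_halves_coeff j * three_halves_coeff (n - j)) else 0)"
      unfolding coeff2_Q_poly by (rule sum.cong) auto
    then show "coeff2 (Q_poly n) (2 * (n - i)) (2 * i) = fact n / 2 ^ n * (three_halves_coeff i * three_halves_coeff (n - i))"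
      using i by simp
  qed
  also have "\<dots> = fact n / 2 ^ n * (4 ^ n * (of_nat (n + 1) * of_nat (n + 2) / 2))"
    by (simp only: sum_distrib_left[symmetric] three_halves_coeff_convolution_sum)
  also have "(4 :: complex) ^ n = 2 ^ n * 2 ^ n"
    by (simp flip: power_mult_distrib)
  also have "fact n / 2 ^ n * (2 ^ n * 2 ^ n * (of_nat (n + 1) * of_nat (n + 2) / 2)) =
      2 ^ n / 2 * (fact (n + 2) :: complex)"
    by (simp add: fact_reduce field_simps)
  finally show ?thesis .
qed

section \<open>Absolute convergence on the closed disc\<close>

text \<open>
  The sum telescopes: with \<open>c\<^sub>n\<close> the absolute value of the binomial coefficient of \<open>-1/2\<close> over \<open>n\<close>,
  the absolute value of that of \<open>1/2\<close> over \<open>n + 1\<close> is \<open>c\<^sub>n/(2n+2) = c\<^sub>n - c\<^sub>n\<^sub>+\<^sub>1\<close>.  So the partial sums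
  are bounded by \<open>c\<^sub>0\<close>.
\<close>

lemma summable_norm_gbinomial_half: "summable (\<lambda>n. norm ((1 / 2 :: complex) gchoose n))"
proof -
  define c where "c n = norm ((-1 / 2 :: complex) gchoose n)" for n
  have c: "c (Suc n) = (2 * real n + 1) / (2 * real n + 2) * c n" for n
  proof -
    have "of_nat (Suc n) * ((-1 / 2 :: complex) gchoose (Suc n)) = (-1 / 2 - of_nat n) * ((-1 / 2) gchoose n)"
      using gbinomial_mult_1[of "-1 / 2 :: complex" n] by (simp add: algebra_simps)
    also have "-1 / 2 - of_nat n = - (of_nat (2 * n + 1) / 2 :: complex)"
      by (simp add: field_simps)
    finally have "of_nat (Suc n) * ((-1 / 2 :: complex) gchoose (Suc n)) =
        - (of_nat (2 * n + 1) / 2) * ((-1 / 2) gchoose n)" .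
    from arg_cong[OF this, of norm] have "real (Suc n) * c (Suc n) = real (2 * n + 1) / 2 * c n"
      unfolding norm_mult norm_minus_cancel norm_divide norm_of_nat c_def by simp
    then show ?thesis by (simp add: field_simps)
  qed
  have b: "norm ((1 / 2 :: complex) gchoose (Suc n)) = c n - c (Suc n)" for n
  proof -
    have "(1 / 2 :: complex) gchoose (Suc n) = (1 / 2) / of_nat (Suc n) * ((-1 / 2) gchoose n)"
      using gbinomial_factors[of "-1 / 2 :: complex" n] by simp
    then have "norm ((1 / 2 :: complex) gchoose (Suc n)) = (1 / 2) / real (Suc n) * c n"
      by (simp only: norm_mult norm_divide norm_of_nat c_def) simp
    also have "\<dots> = c n - c (Suc n)"
      unfolding c by (simp add: field_simps)
    finally show ?thesis .
  qed
  have "summable (\<lambda>n. norm ((1 / 2 :: complex) gchoose (Suc n)))"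
  proof (rule summableI_nonneg_bounded)
    show "(\<Sum>i<n. norm ((1 / 2 :: complex) gchoose (Suc i))) \<le> c 0" for n
      unfolding b sum_lessThan_telescope' by (simp add: c_def)
  qed simp
  then show ?thesis
    using summable_Suc_iff[of "\<lambda>n. norm ((1 / 2 :: complex) gchoose n)"] by simp
qed

lemma summable_sqrt_product:
  fixes x y :: complex
  assumes "norm x \<le> 1" "norm y \<le> 1"
  shows "summable (\<lambda>k. norm (\<Sum>i=0..k. ((1 / 2 gchoose i) * x ^ i) * ((1 / 2 gchoose (k - i)) * y ^ (k - i))))"
proof (rule summable_comparison_test')
  let ?b = "\<lambda>n. norm ((1 / 2 :: complex) gchoose n)"
  show "summable (\<lambda>k. \<Sum>i\<le>k. ?b i * ?b (k - i))"
    by (rule summable_Cauchy_product) (simp_all add: summable_norm_gbinomial_half)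
  fix k :: nat
  assume "0 \<le> k"
  have t: "norm ((1 / 2 gchoose i) * w ^ i) \<le> ?b i" if "norm w \<le> 1" for i and w :: complex
    using that by (simp add: norm_mult norm_power mult_left_le power_le_one)
  have "norm (\<Sum>i=0..k. ((1 / 2 gchoose i) * x ^ i) * ((1 / 2 gchoose (k - i)) * y ^ (k - i))) \<le>
      (\<Sum>i=0..k. norm ((1 / 2 gchoose i) * x ^ i) * norm ((1 / 2 gchoose (k - i)) * y ^ (k - i)))"
    by (rule sum_norm_le) (simp add: norm_mult)
  also have "\<dots> \<le> (\<Sum>i=0..k. ?b i * ?b (k - i))"
    by (intro sum_mono mult_mono t[OF assms(1)] t[OF assms(2)]) auto
  finally show "norm (norm (\<Sum>i=0..k. ((1 / 2 gchoose i) * x ^ i) * ((1 / 2 gchoose (k - i)) * y ^ (k - i)))) \<le>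
      (\<Sum>i\<le>k. ?b i * ?b (k - i))"
    by (simp add: atLeast0AtMost)
qed

section \<open>The series of the solution at z = 0\<close>

theorem theorem5p1:
  fixes \<alpha> \<beta> :: complex and \<psi> :: "complex \<Rightarrow> complex \<Rightarrow> complex" and r :: real
    and a :: "nat \<Rightarrow> nat \<Rightarrow> complex" and \<mu> :: real
  assumes "\<alpha> + \<beta> \<noteq> 0"
    and "r > 0"
    and "\<And>k l. a k l = taylor_coeff \<psi> k l"
    and "\<And>u z. norm u < r \<Longrightarrow> norm z < r \<Longrightarrow>
           ((\<lambda>(k, l). a k l * u ^ k * z ^ l) has_sum \<psi> u z) UNIV"
    and "\<And>u z. norm u < r \<Longrightarrow> norm z < r \<Longrightarrow>
           - \<psi> u z * pd_u \<psi> u z + u * (pd_u \<psi> u z)\<^sup>2 + 1 / 2 * (pd_z \<psi> u z)\<^sup>2 = 0"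
    and "deriv_at_0 \<psi> 0 0 = 1"
    and "deriv_at_0 \<psi> 0 1 = \<alpha> + \<beta>"
    and "deriv_at_0 \<psi> 0 2 = 2 * \<alpha> * \<beta>"
    and "\<And>l. l \<ge> 3 \<Longrightarrow> deriv_at_0 \<psi> 0 l = 0"
    and "\<mu> = max (norm \<alpha>) (norm \<beta>)"
  shows "(\<forall>u. norm u < r \<longrightarrow> (\<lambda>k. a k 0 * u ^ k) sums \<psi> u 0) \<and>
         a 0 0 = 1 \<and>
         a 1 0 = 1 / 2 * (\<alpha> + \<beta>)\<^sup>2 \<and>
         (\<forall>k\<ge>2. a k 0 = (-1) ^ (k + 1) / (2 * fact k) * (\<alpha> - \<beta>)\<^sup>2 * (\<alpha> + \<beta>)\<^sup>2 * Q k \<alpha> \<beta>) \<and>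
         (\<forall>k\<ge>2. \<exists>P. (\<forall>x y. eval2 P x y = Q k x y) \<and> symmetric2 P \<and> homogeneous2 (2 * k - 4) P \<and>
            (\<Sum>j = 1..k - 1. coeff2 P (2 * k - 2 * j - 2) (2 * j - 2)) =
              2 powi (int k - 3) * fact k) \<and>
         (\<forall>u :: complex. norm u \<le> 1 / (2 * \<mu>\<^sup>2) \<longrightarrow> summable (\<lambda>k. norm (a k 0 * u ^ k)))"
proof -
  define F where "F = Abs_fps (\<lambda>k. Abs_fps (a k))"
  have F_nth: "fps_nth (fps_nth F k) l = a k l" for k l
    by (simp add: F_def)
  have initial: "fps_nth F 0 = (1 + fps_const \<alpha> * fps_X) * (1 + fps_const \<beta> * fps_X)"
  proof (rule fps_ext)
    fix l :: nat
    have prod: "(1 + fps_const \<alpha> * fps_X) * (1 + fps_const \<beta> * fps_X) =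
        1 + fps_const (\<alpha> + \<beta>) * fps_X + fps_const (\<alpha> * \<beta>) * fps_X ^ 2"
      unfolding fps_const_add[symmetric] fps_const_mult[symmetric]
      by (simp add: algebra_simps power2_eq_square del: fps_const_add fps_const_mult)
    consider "l = 0" | "l = 1" | "l = 2" | "l \<ge> 3" by linarith
    then show "fps_nth (fps_nth F 0) l =
        fps_nth ((1 + fps_const \<alpha> * fps_X) * (1 + fps_const \<beta> * fps_X)) l"
      unfolding prod F_nth assms(3) taylor_coeff_def
      by cases (auto simp: assms(6-9) assms(7)[unfolded One_nat_def] fps_X_nth fps_X_power_nth)
  qed
  have "fps_nth (fps_nth F 0) 0 = 1" unfolding initial by simp
  then have "fps_nth F 0 \<noteq> 0" by auto
  moreover have "formal_solution F"
    unfolding F_def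
    by (rule formal_solution_of_analytic_solution[OF assms(2) assms(4,5)])
  ultimately have F_eq: "F = explicit_solution \<alpha> \<beta>"
    by (intro formal_solution_unique formal_solution_explicit_solution)
       (simp_all only: initial explicit_solution_nth_0 not_False_eq_True)
  \<comment> \<open>The coefficients of the square root of \<open>(1 + 2\<alpha>\<^sup>2u)(1 + 2\<beta>\<^sup>2u)\<close>.\<close>
  define s where "s k = (\<Sum>i=0..k. ((1 / 2 gchoose i) * (2 * \<alpha>\<^sup>2) ^ i) *
      ((1 / 2 gchoose (k - i)) * (2 * \<beta>\<^sup>2) ^ (k - i)))" for k
  have coeff: "2 * a k 0 = (if k = 0 then 1 else 0) + (if k = 1 then 2 * \<alpha> * \<beta> else 0) + s k" for k
    using explicit_solution_nth_nth_0[of \<alpha> \<beta> k] by (simp only: F_eq[symmetric] F_nth s_def)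
  have a_0: "a 0 0 = 1"
    using coeff[of 0] by (simp add: s_def)
  have "2 * a 1 0 = 2 * (1 / 2 * (\<alpha> + \<beta>)\<^sup>2)"
    unfolding coeff by (simp add: s_def power2_eq_square algebra_simps)
  then have a_1: "a 1 0 = 1 / 2 * (\<alpha> + \<beta>)\<^sup>2"
    by (simp only: mult_cancel_left) simp
  have a_k: "a k 0 = (-1) ^ (k + 1) / (2 * fact k) * (\<alpha> - \<beta>)\<^sup>2 * (\<alpha> + \<beta>)\<^sup>2 * Q k \<alpha> \<beta>"
    if "k \<ge> 2" for k
  proof -
    define n where "n = k - 2"
    have k: "k = n + 2" using that by (simp add: n_def)
    have "2 * a k 0 = (-1) ^ (n + 3) / fact (n + 2) * (\<alpha> - \<beta>)\<^sup>2 * (\<alpha> + \<beta>)\<^sup>2 * Q (n + 2) \<alpha> \<beta>"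
      unfolding coeff unfolding k s_def sqrt_product_coeff_Q by simp
    then have "a k 0 = ((-1) ^ (n + 3) / fact (n + 2) * (\<alpha> - \<beta>)\<^sup>2 * (\<alpha> + \<beta>)\<^sup>2 * Q (n + 2) \<alpha> \<beta>) / 2"
      by (metis nonzero_mult_div_cancel_left zero_neq_numeral)
    also have "n + 3 = k + 1" using k by simp
    finally show ?thesis unfolding k[symmetric] by simp
  qed
  have sums: "(\<lambda>k. a k 0 * u ^ k) sums \<psi> u 0" if "norm u < r" for u
    using iterated_sums[of r a \<psi> u 0, OF assms(2,4) that] assms(2) by (simp add: eval_fps_at_0)
  have poly: "\<exists>P. (\<forall>x y. eval2 P x y = Q k x y) \<and> symmetric2 P \<and> homogeneous2 (2 * k - 4) P \<and>
      (\<Sum>j = 1..k - 1. coeff2 P (2 * k - 2 * j - 2) (2 * j - 2)) = 2 powi (int k - 3) * fact k"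
    if "k \<ge> 2" for k
  proof -
    define n where "n = k - 2"
    have k: "k = n + 2" using that by (simp add: n_def)
    have "(\<Sum>j = 1..k - 1. coeff2 (Q_poly n) (2 * k - 2 * j - 2) (2 * j - 2)) =
        (\<Sum>i=0..n. coeff2 (Q_poly n) (2 * (n - i)) (2 * i))"
    proof (rule sum.reindex_bij_witness[of _ "\<lambda>i. i + 1" "\<lambda>j. j - 1"])
      fix j assume j: "j \<in> {1..k - 1}"
      have "2 * (n - (j - 1)) = 2 * k - 2 * j - 2" "2 * (j - 1) = 2 * j - 2"
        using j k by auto
      then show "coeff2 (Q_poly n) (2 * (n - (j - 1))) (2 * (j - 1)) =
          coeff2 (Q_poly n) (2 * k - 2 * j - 2) (2 * j - 2)" by simp
    qed (auto simp: k)
    also have "\<dots> = 2 ^ n / 2 * fact k"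
      unfolding coeff_sum_Q_poly k ..
    also have "(2 ^ n / 2 :: complex) = 2 powi (int k - 3)"
      using power_int_diff[of "2 :: complex" "int n" 1] by (simp add: k)
    finally show ?thesis
      using eval2_Q_poly[of n] symmetric2_Q_poly[of n] homogeneous2_Q_poly[of n] k
      by (intro exI[of _ "Q_poly n"]) simp
  qed
  have summable: "summable (\<lambda>k. norm (a k 0 * u ^ k))" if u: "norm u \<le> 1 / (2 * \<mu>\<^sup>2)" for u
  proof (rule summable_comparison_test')
    \<comment> \<open>If \<open>\<mu>\<close> were zero, then so would be \<open>\<alpha> + \<beta>\<close>.\<close>
    have "\<mu> \<noteq> 0" using assms(1,10) by (auto simp: max_def split: if_splits)
    then have \<mu>: "0 < \<mu>\<^sup>2" by simp
    have le: "norm (2 * x\<^sup>2 * u) \<le> 1" if "norm x \<le> \<mu>" for x :: complex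
    proof -
      have "norm (2 * x\<^sup>2 * u) = 2 * (norm x)\<^sup>2 * norm u" by (simp add: norm_mult norm_power)
      also have "\<dots> \<le> 2 * \<mu>\<^sup>2 * (1 / (2 * \<mu>\<^sup>2))"
        using that u by (intro mult_mono power_mono) auto
      also have "\<dots> = 1" using \<mu> by simp
      finally show ?thesis .
    qed
    have "(\<Sum>i=0..k. ((1 / 2 gchoose i) * (2 * \<alpha>\<^sup>2 * u) ^ i) *
        ((1 / 2 gchoose (k - i)) * (2 * \<beta>\<^sup>2 * u) ^ (k - i))) = s k * u ^ k" for k
      unfolding s_def sum_distrib_right
    proof (rule sum.cong[OF refl])
      fix i assume "i \<in> {0..k}"
      then have "u ^ k = u ^ i * u ^ (k - i)" by (simp flip: power_add)
      then show "((1 / 2 gchoose i) * (2 * \<alpha>\<^sup>2 * u) ^ i) * ((1 / 2 gchoose (k - i)) * (2 * \<beta>\<^sup>2 * u) ^ (k - i)) =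
          ((1 / 2 gchoose i) * (2 * \<alpha>\<^sup>2) ^ i) * ((1 / 2 gchoose (k - i)) * (2 * \<beta>\<^sup>2) ^ (k - i)) * u ^ k"
        by (simp only: power_mult_distrib mult_ac)
    qed
    then show "summable (\<lambda>k. norm (s k * u ^ k))"
      using summable_sqrt_product[of "2 * \<alpha>\<^sup>2 * u" "2 * \<beta>\<^sup>2 * u"] le[of \<alpha>] le[of \<beta>] assms(10) by simp
    \<comment> \<open>From \<open>k = 2\<close> on, the polynomial part \<open>1 + 2\<alpha>\<beta>u\<close> does not contribute.\<close>
    fix k :: nat assume "2 \<le> k"
    then have "2 * (a k 0 * u ^ k) = s k * u ^ k" using coeff[of k] by (simp flip: mult.assoc)
    from arg_cong[OF this, of norm] have "2 * norm (a k 0 * u ^ k) = norm (s k * u ^ k)"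
      by (simp add: norm_mult)
    then show "norm (norm (a k 0 * u ^ k)) \<le> norm (s k * u ^ k)"
      using norm_ge_zero[of "a k 0 * u ^ k"] unfolding real_norm_def abs_norm_cancel by linarith
  qed
  show ?thesis
    using sums a_0 a_1 a_k poly summable by blast
qed

end
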